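(* Let $\mathcal{X}\subseteq\mathbb{R}$, let $\mathcal{B}\subseteq\mathbb{R}$ be convex, and let $J:\mathcal{X}\times\mathcal{B}\to\mathbb{R}$ be continuous, concave in $b$ on $\mathcal{B}$ for every $x\in\mathcal{X}$, and concave in $x$ on $\mathcal{X}$ for every $b\in\mathcal{B}$. Let $g_1,\dots,g_n:\mathcal{X}\to\mathbb{R}$ be measurable. For $\epsilon\in\mathbb{R}^n$ let $\mathcal{F}(\epsilon)$ be the set of all probability distributions $F$ on $\mathcal{X}$ with $\mathbb{E}_{x\sim F}\,g_i(x)\le\epsilon_i$ for $i=1,\dots,n$, and let $$P^*(\epsilon)=\sup_{b\in\mathcal{B}}\ \inf_{F\in\mathcal{F}(\epsilon)}\ \mathbb{E}_{x\sim F}\,J(x,b).$$ Fix $\epsilon\in\mathbb{R}^n$ and assume that there exists a probability distribution $F$ on $\mathcal{X}$ such that $\mathbb{E}_{x\sim F}\,g_i(x)<\epsilon_i$ for all $i=1,\dots,n$. Let $(b^*(\epsilon),\lambda^*(\epsilon),\eta^*(\epsilon))$ be an optimal solution of the problem $$\begin{aligned}\underset{b,\lambda,\eta}{\text{maximize}}\quad & -\sum_{i=1}^n\lambda_i\epsilon_i-\eta\\ \text{subject to}\quad & J(x,b)+\sum_{i=1}^n\lambda_i g_i(x)+\eta\ge 0\quad\text{for all }x\in\mathcal{X},\\ & b\in\mathcal{B},\ \lambda\in\mathbb{R}^n_+,\ \eta\in\mathbb{R}.\end{aligned}$$ Then for every $\Delta\epsilon\in\mathbb{R}^n$, $$P^*(\epsilon-\Delta\epsilon)\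 \ge\ P^*(\epsilon)+\sum_{i=1}^n\lambda_i^*(\epsilon)\,\Delta\epsilon_i .$$
   Context: $\mathbb{R}^n_+$ is the set of vectors with nonnegative entries. $\mathcal{X}$ carries its Borel $\sigma$-algebra; a probability distribution on $\mathcal{X}$ is a Borel probability measure on $\mathcal{X}$, and $\mathbb{E}_{x\sim F}\,h(x)=\int_{\mathcal{X}}h\,dF$. Only distributions for which the integrals in question are defined are considered: the conditions $\mathbb{E}_{x\sim F}\,g_i(x)\le\epsilon_i$ (or $<\epsilon_i$) include that $g_i$ is $F$-integrable, and the infimum of $\mathbb{E}_{x\sim F}\,J(x,b)$ is taken over those $F\in\mathcal{F}(\epsilon)$ for which $J(\cdot,b)$ is $F$-integrable. Optimal values are suprema/infima in $[-\infty,+\infty]$ (with $\inf\emptyset=+\infty$, so that $P^*(\epsilon-\Delta\epsilon)=+\infty$ if $\mathcal{F}(\epsilon-\Delta\epsilon)=\emptyset$). An optimal solution is a feasible point attaining the (finite) optimal value. Concavity in $x$ on $\mathcal{X}$ means that the concavity inequality holds whenever all points involved lie in $\mathcal{X}$. *)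

theory Defs
  imports "HOL-Probability.Probability"
begin

text \<open>
  The set \<open>X\<close> need not be Borel in \<open>\<real>\<close>; its Borel sigma-algebra (for the subspace
  topology) is the trace sigma-algebra \<open>restrict_space borel X\<close>.
\<close>

definition distributions :: "real set \<Rightarrow> real measure set" where
  "distributions X = {F. prob_space F \<and> sets F = sets (restrict_space borel X)}"

text \<open>
  Since \<open>X\<close> need not be convex, concavity in \<open>x\<close> cannot be expressed by \<^const>\<open>concave_on\<close>, which
  presupposes a convex domain. The inequality is required whenever the intermediate point is in \<open>X\<close>.
\<close>

definition concave_within :: "real set \<Rightarrow> (real \<Rightarrow> real) \<Rightarrow> bool" where
  "concave_within X f \<longleftrightarrow>
    (\<forall>x\<in>X. \<forall>y\<in>X. \<forall>t\<in>{0..1}. (1 - t) * x + t * y \<in> X \<longrightarrow>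
      (1 - t) * f x + t * f y \<le> f ((1 - t) * x + t * y))"

text \<open>
  Integrability is stated explicitly, because the Bochner integral of a non-integrable function is
  \<open>0\<close> by convention.
\<close>

definition ambiguity_set ::
    "real set \<Rightarrow> ('n::finite \<Rightarrow> real \<Rightarrow> real) \<Rightarrow> real ^ 'n \<Rightarrow> real measure set" where
  "ambiguity_set X g \<epsilon> =
    {F \<in> distributions X. \<forall>i. integrable F (g i) \<and> (\<integral>x. g i x \<partial>F) \<le> \<epsilon> $ i}"

definition strictly_feasible ::
    "real set \<Rightarrow> ('n::finite \<Rightarrow> real \<Rightarrow> real) \<Rightarrow> real ^ 'n \<Rightarrow> bool" where
  "strictly_feasible X g \<epsilon> \<longleftrightarrow>
    (\<exists>F \<in> distributions X. \<forall>i. integrable F (g i) \<and> (\<integral>x. g i x \<partial>F) < \<epsilon> $ i)"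

definition primal_value ::
    "real set \<Rightarrow> real set \<Rightarrow> (real \<Rightarrow> real \<Rightarrow> real) \<Rightarrow> ('n::finite \<Rightarrow> real \<Rightarrow> real) \<Rightarrow>
      real ^ 'n \<Rightarrow> ereal" where
  "primal_value X B J g \<epsilon> =
    (SUP b\<in>B. INF F\<in>{F \<in> ambiguity_set X g \<epsilon>. integrable F (\<lambda>x. J x b)}.
      ereal (\<integral>x. J x b \<partial>F))"

definition dual_feasible ::
    "real set \<Rightarrow> real set \<Rightarrow> (real \<Rightarrow> real \<Rightarrow> real) \<Rightarrow> ('n::finite \<Rightarrow> real \<Rightarrow> real) \<Rightarrow>
      (real \<times> (real ^ 'n) \<times> real) set" where
  "dual_feasible X B J g =
    {(b, l, \<eta>). b \<in> B \<and> (\<forall>i. 0 \<le> l $ i) \<and>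
      (\<forall>x\<in>X. 0 \<le> J x b + (\<Sum>i\<in>UNIV. l $ i * g i x) + \<eta>)}"

definition dual_objective :: "real ^ 'n::finite \<Rightarrow> real \<times> (real ^ 'n) \<times> real \<Rightarrow> real" where
  "dual_objective \<epsilon> = (\<lambda>(b, l, \<eta>). - (\<Sum>i\<in>UNIV. l $ i * \<epsilon> $ i) - \<eta>)"

definition dual_optimal ::
    "real set \<Rightarrow> real set \<Rightarrow> (real \<Rightarrow> real \<Rightarrow> real) \<Rightarrow> ('n::finite \<Rightarrow> real \<Rightarrow> real) \<Rightarrow>
      real ^ 'n \<Rightarrow> real \<times> (real ^ 'n) \<times> real \<Rightarrow> bool" where
  "dual_optimal X B J g \<epsilon> p \<longleftrightarrow>
    p \<in> dual_feasible X B J g \<and>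
    ereal (dual_objective \<epsilon> p) = (SUP q\<in>dual_feasible X B J g. ereal (dual_objective \<epsilon> q))"

end

theory Submission
  imports Defs
begin

text \<open>
  Weak duality at the perturbed level bounds \<open>P\<^sup>*(\<epsilon> - \<Delta>\<epsilon>)\<close> from below by the objective of the
  given multipliers, which is the dual value at \<open>\<epsilon>\<close> plus \<open>\<lambda>\<^sup>* \<bullet> \<Delta>\<epsilon>\<close>. It remains to see that
  \<open>P\<^sup>*(\<epsilon>)\<close> is at most the dual value. For fixed \<open>b\<close> and real \<open>r\<close>, compare the convex hull of the
  points \<open>(g x, J x b)\<close> with the open orthant below \<open>(\<epsilon>, r)\<close>. If they meet, a finitely supported
  distribution shows that the inner infimum is below \<open>r\<close>. If not, a separating hyperplane yields
  multipliers with dual value \<open>r\<close>; strict feasibility ensures that the hyperplane is not vertical.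
\<close>

section \<open>Finitely supported distributions and their moments\<close>

text \<open>The weights are put on the index set and pushed forward along \<open>z\<close>, so
  coinciding points \<open>z i\<close> simply add up their masses.\<close>

lemma finitely_supported_distribution:
  fixes u :: "'i \<Rightarrow> real" and z :: "'i \<Rightarrow> real"
  assumes "finite A" and "\<And>i. i \<in> A \<Longrightarrow> 0 \<le> u i" and "sum u A = 1"
    and "\<And>i. i \<in> A \<Longrightarrow> z i \<in> X"
  obtains F where "F \<in> distributions X"
    and "\<And>h :: real \<Rightarrow> real. h \<in> borel_measurable (restrict_space borel X) \<Longrightarrow>
      integrable F h \<and> (\<integral>x. h x \<partial>F) = (\<Sum>i\<in>A. u i * h (z i))"
proof
  let ?P = "point_measure A (\<lambda>i. ennreal (u i))"
  let ?F = "distr ?P (restrict_space borel X) z"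
  have z: "z \<in> measurable ?P (restrict_space borel X)"
    using assms(4) by (auto simp: measurable_point_measure_eq1 space_restrict_space)
  have "emeasure ?P A = (\<Sum>i\<in>A. ennreal (u i))"
    using assms(1) by (simp add: emeasure_point_measure_finite)
  also have "\<dots> = 1"
    using assms(2,3) by (simp add: sum_ennreal)
  finally have "prob_space ?P"
    by (auto intro!: prob_spaceI simp: space_point_measure)
  then show "?F \<in> distributions X"
    using z by (simp add: distributions_def prob_space.prob_space_distr)
  fix h :: "real \<Rightarrow> real"
  assume h: "h \<in> borel_measurable (restrict_space borel X)"
  have "integrable ?F h"
    using assms(1,2) by (simp add: integrable_distr_eq[OF z h] integrable_point_measure_finite)
  moreover have "(\<integral>x. h x \<partial>?F) = (\<Sum>i\<in>A. u i * h (z i))"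
    using assms(1,2) by (simp add: integral_distr[OF z h] lebesgue_integral_point_measure_finite)
  ultimately show "integrable ?F h \<and> (\<integral>x. h x \<partial>?F) = (\<Sum>i\<in>A. u i * h (z i))" ..
qed

text \<open>A convex combination of moment points is the vector of expectations under the mixture of
  point masses with the same weights.\<close>

lemma convex_hull_moments_distribution:
  fixes g :: "'n::finite \<Rightarrow> real \<Rightarrow> real" and h :: "real \<Rightarrow> real"
  assumes "\<And>i. g i \<in> borel_measurable (restrict_space borel X)"
    and "h \<in> borel_measurable (restrict_space borel X)"
    and "p \<in> convex hull ((\<lambda>x. (\<chi> i. g i x, h x)) ` X)"
  obtains F where "F \<in> distributions X"
    and "\<And>i. integrable F (g i)" and "\<And>i. (\<integral>x. g i x \<partial>F) = fst p $ i"
    and "integrable F h" and "(\<integral>x. h x \<partial>F) = snd p"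
proof -
  obtain k :: nat and u :: "nat \<Rightarrow> real" and q
    where u: "\<And>j. j \<in> {1..k} \<Longrightarrow> 0 \<le> u j" "sum u {1..k} = 1"
      and q: "\<And>j. j \<in> {1..k} \<Longrightarrow> q j \<in> (\<lambda>x. (\<chi> i. g i x, h x)) ` X"
      and p: "(\<Sum>j\<in>{1..k}. u j *\<^sub>R q j) = p"
    using assms(3) unfolding convex_hull_indexed by blast
  have "\<forall>j\<in>{1..k}. \<exists>x\<in>X. q j = (\<chi> i. g i x, h x)"
    using q by blast
  then obtain z where z: "\<And>j. j \<in> {1..k} \<Longrightarrow> z j \<in> X \<and> q j = (\<chi> i. g i (z j), h (z j))"
    by metis
  obtain F where F: "F \<in> distributions X"
    and int: "\<And>f :: real \<Rightarrow> real. f \<in> borel_measurable (restrict_space borel X) \<Longrightarrow>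
      integrable F f \<and> (\<integral>x. f x \<partial>F) = (\<Sum>j\<in>{1..k}. u j * f (z j))"
    by (rule finitely_supported_distribution[of "{1..k}" u z X]) (use u z in auto)
  have "fst p $ i = (\<Sum>j\<in>{1..k}. u j * g i (z j))" for i
    unfolding p[symmetric] using z by (simp add: fst_sum)
  moreover have "snd p = (\<Sum>j\<in>{1..k}. u j * h (z j))"
    unfolding p[symmetric] using z by (simp add: snd_sum)
  ultimately show thesis
    using that F int assms(1,2) by metis
qed

section \<open>Separation of the moment hull from an open orthant\<close>

text \<open>The orthant extends without bound in every negative coordinate direction, so a
  functional bounded above on it has no negative coefficient. Its corner is a limit of points of the
  orthant and inherits the bound.\<close>

lemma inner_bounded_on_open_orthant:
  fixes a \<epsilon> :: "real ^ 'n::finite" and c r \<beta> :: real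
  assumes "\<forall>p\<in>{z. \<forall>i. z $ i < \<epsilon> $ i} \<times> {..<r}. (a, c) \<bullet> p \<le> \<beta>"
  shows "0 \<le> a $ i" and "0 \<le> c" and "a \<bullet> \<epsilon> + c * r \<le> \<beta>"
proof -
  \<comment> \<open>The test point starts at the corner. The shift by \<open>d\<close> in all
    coordinates makes the inequalities strict; \<open>k\<close> and \<open>m\<close> move it further
    along coordinate \<open>i\<close> and the last one.\<close>
  have *: "a \<bullet> (\<epsilon> - d *\<^sub>R 1 - k *\<^sub>R axis i 1) + c * (r - d - m) \<le> \<beta>"
    if "0 < d" "0 \<le> k" "0 \<le> m" for d k m i
  proof -
    have "(\<epsilon> - d *\<^sub>R 1 - k *\<^sub>R axis i 1) $ j < \<epsilon> $ j" for j
      using that by (simp add: axis_def)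
    then show ?thesis
      using bspec[OF assms, of "(\<epsilon> - d *\<^sub>R 1 - k *\<^sub>R axis i 1, r - d - m)"] that by simp
  qed
  have **: "a \<bullet> \<epsilon> + c * r - \<beta> \<le> d * (a \<bullet> 1 + c) + k * (a $ i) + m * c"
    if "0 < d" "0 \<le> k" "0 \<le> m" for d k m i
    using *[OF that, of i] by (simp add: inner_diff_right inner_axis algebra_simps)
  have nonneg: "0 \<le> s" if "\<And>k. 0 \<le> k \<Longrightarrow> w \<le> k * s" for s w :: real
  proof (rule ccontr)
    assume "\<not> 0 \<le> s"
    then have s: "s < 0" by simp
    \<comment> \<open>This \<open>k\<close> makes \<open>k * s\<close> equal to
      \<open>- (1 + \<bar>w\<bar>)\<close>, which is less than \<open>w\<close>.\<close>
    have "w \<le> (1 + \<bar>w\<bar>) / (- s) * s"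
      using s by (intro that) (simp add: divide_nonneg_neg)
    then show False
      using s by simp
  qed
  \<comment> \<open>For the signs, \<open>d\<close> is frozen at 1 and \<open>k\<close> or
    \<open>m\<close> ranges over all nonnegative reals.\<close>
  show "0 \<le> a $ i"
    by (rule nonneg[of "a \<bullet> \<epsilon> + c * r - \<beta> - (a \<bullet> 1 + c)"])
      (use **[of 1 _ 0 i] in \<open>simp add: diff_le_eq add.commute\<close>)
  show "0 \<le> c"
    by (rule nonneg[of "a \<bullet> \<epsilon> + c * r - \<beta> - (a \<bullet> 1 + c)"])
      (use **[of 1 0] in \<open>simp add: diff_le_eq add.commute\<close>)
  \<comment> \<open>With \<open>k\<close> and \<open>m\<close> zero, letting \<open>d\<close> tend
    to 0 from above reaches the corner.\<close>
  have "((\<lambda>d. d * (a \<bullet> 1 + c)) \<longlongrightarrow> 0 * (a \<bullet> 1 + c)) (at_right 0)"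
    by (intro tendsto_intros)
  moreover have "\<forall>\<^sub>F d in at_right 0. a \<bullet> \<epsilon> + c * r - \<beta> \<le> d * (a \<bullet> 1 + c)"
    using **[of _ 0 0] by (auto intro: eventually_mono[OF eventually_at_right_less])
  ultimately have "a \<bullet> \<epsilon> + c * r - \<beta> \<le> 0 * (a \<bullet> 1 + c)"
    by (rule tendsto_lowerbound) simp
  then show "a \<bullet> \<epsilon> + c * r \<le> \<beta>"
    by simp
qed

text \<open>A theorem of the alternative for a fixed decision: either some Lagrangian is at least
  \<open>r\<close> on all of \<open>X\<close>, or a feasible distribution has expectation below
  \<open>r\<close>. In the separating case the multipliers are the normal vector scaled so that the
  coefficient of \<open>h\<close> is 1.\<close>

lemma multipliers_or_distribution:
  fixes g :: "'n::finite \<Rightarrow> real \<Rightarrow> real" and h :: "real \<Rightarrow> real"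
  assumes g: "\<And>i. g i \<in> borel_measurable (restrict_space borel X)"
    and h: "h \<in> borel_measurable (restrict_space borel X)"
    and slater: "strictly_feasible X g \<epsilon>"
  obtains (multipliers) l :: "real ^ 'n" where "\<And>i. 0 \<le> l $ i"
      and "\<And>x. x \<in> X \<Longrightarrow> r \<le> h x + (\<Sum>i\<in>UNIV. l $ i * (g i x - \<epsilon> $ i))"
    | (distribution) F where "F \<in> ambiguity_set X g \<epsilon>" and "integrable F h"
      and "(\<integral>x. h x \<partial>F) < r"
proof -
  let ?C = "convex hull ((\<lambda>x. (\<chi> i. g i x, h x)) ` X)"
  let ?O = "{z. \<forall>i. z $ i < \<epsilon> $ i} \<times> {..<r}"
  obtain F0 where F0: "prob_space F0" "sets F0 = sets (restrict_space borel X)"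
    and F0g: "\<And>i. integrable F0 (g i)" "\<And>i. (\<integral>x. g i x \<partial>F0) < \<epsilon> $ i"
    using slater by (auto simp: strictly_feasible_def distributions_def)
  interpret prob_space F0 by fact
  have space: "space F0 = X"
    using sets_eq_imp_space_eq[OF F0(2)] by (simp add: space_restrict_space)
  show thesis
  proof (cases "?C \<inter> ?O = {}")
    case False
    then obtain z t where zt: "(z, t) \<in> ?C" "\<And>i. z $ i < \<epsilon> $ i" "t < r"
      by auto
    obtain F where "F \<in> distributions X" "\<And>i. integrable F (g i)"
      "\<And>i. (\<integral>x. g i x \<partial>F) = z $ i" "integrable F h" "(\<integral>x. h x \<partial>F) = t"
      using convex_hull_moments_distribution[OF g h zt(1)] by auto
    then show thesis
      using zt by (intro distribution[of F]) (auto simp: ambiguity_set_def intro: less_imp_le)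
  next
    case True
    have "{z. \<forall>i. z $ i < \<epsilon> $ i} = (\<Inter>i. {z. axis i 1 \<bullet> z < \<epsilon> $ i})"
      by (auto simp: inner_axis')
    then have "convex ?O"
      by (auto intro!: convex_Times convex_INT convex_halfspace_lt)
    moreover have "(\<epsilon> - 1, r - 1) \<in> ?O"
      by simp
    then have "?O \<noteq> {}"
      by (rule ex_in_conv[THEN iffD1, OF exI])
    \<comment> \<open>\<open>X\<close> is nonempty because it carries the probability measure
      \<open>F0\<close>.\<close>
    moreover have "?C \<noteq> {}"
      using not_empty space by simp
    moreover have "?O \<inter> ?C = {}"
      using True by (subst Int_commute)
    ultimately have "\<exists>ac \<beta>. ac \<noteq> 0 \<and> (\<forall>p\<in>?O. ac \<bullet> p \<le> \<beta>) \<and> (\<forall>p\<in>?C. \<beta> \<le> ac \<bullet> p)"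
      by (intro separating_hyperplane_sets convex_convex_hull)
    then obtain ac \<beta> where ac: "ac \<noteq> 0"
      and O: "\<forall>p\<in>?O. ac \<bullet> p \<le> \<beta>" and C: "\<forall>p\<in>?C. \<beta> \<le> ac \<bullet> p"
      by (elim exE conjE)
    obtain a c where ac_eq: "ac = (a, c)"
      by fastforce
    note ac_props = inner_bounded_on_open_orthant[OF O[unfolded ac_eq]]
    \<comment> \<open>The constant \<open>\<beta>\<close> is eliminated: it lies above the value at
      the corner and below the value at each moment point.\<close>
    have sep: "c * r \<le> c * h x + (\<Sum>i\<in>UNIV. a $ i * (g i x - \<epsilon> $ i))" if "x \<in> X" for x
    proof -
      have "\<beta> \<le> ac \<bullet> (\<chi> i. g i x, h x)"
        using that by (intro bspec[OF C] hull_inc) simp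
      then show ?thesis
        using ac_props(3) by (simp add: ac_eq inner_vec_def sum_subtractf algebra_simps)
    qed
    \<comment> \<open>For a vertical hyperplane, \<open>sep\<close> makes the weighted constraint
      residuals nonnegative on \<open>X\<close>. Under the Slater distribution \<open>F0\<close>
      their expectation is negative, since some \<open>a $ j\<close> is positive.\<close>
    have "c \<noteq> 0"
    proof
      assume "c = 0"
      then have "a \<noteq> 0"
        using ac ac_eq by (auto simp: zero_prod_def)
      then obtain j where "a $ j \<noteq> 0"
        by (auto simp: vec_eq_iff)
      then have j: "0 < a $ j"
        using ac_props(1)[of j] by linarith
      have "0 \<le> (\<integral>x. (\<Sum>i\<in>UNIV. a $ i * (g i x - \<epsilon> $ i)) \<partial>F0)"
        using sep \<open>c = 0\<close> space by (intro integral_nonneg_AE AE_I2) simp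
      also have "\<dots> = (\<Sum>i\<in>UNIV. a $ i * ((\<integral>x. g i x \<partial>F0) - \<epsilon> $ i))"
        using F0g(1) by (simp add: prob_space)
      also have "\<dots> < (\<Sum>i::'n\<in>UNIV. 0)"
        using j ac_props(1) F0g(2)
        by (intro sum_strict_mono_ex1)
          (auto intro!: mult_nonneg_nonpos mult_pos_neg bexI[of _ j] simp: less_imp_le)
      finally show False
        by simp
    qed
    then have "0 < c"
      using ac_props(2) by simp
    show thesis
    proof (rule multipliers[of "a /\<^sub>R c"])
      show "0 \<le> (a /\<^sub>R c) $ i" for i
        using ac_props(1) \<open>0 < c\<close> by simp
      show "r \<le> h x + (\<Sum>i\<in>UNIV. (a /\<^sub>R c) $ i * (g i x - \<epsilon> $ i))" if "x \<in> X" for x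
      proof -
        have "(\<Sum>i\<in>UNIV. (a /\<^sub>R c) $ i * (g i x - \<epsilon> $ i)) =
            (\<Sum>i\<in>UNIV. a $ i * (g i x - \<epsilon> $ i)) / c"
          by (simp add: sum_divide_distrib) (simp add: divide_inverse mult_ac)
        moreover have "r \<le> (c * h x + (\<Sum>i\<in>UNIV. a $ i * (g i x - \<epsilon> $ i))) / c"
          using sep[OF that] \<open>0 < c\<close> by (simp only: pos_le_divide_eq mult.commute[of r])
        ultimately show ?thesis
          using \<open>0 < c\<close> by (simp only: add_divide_distrib) simp
      qed
    qed
  qed
qed

section \<open>Weak and strong duality, and the sensitivity bound\<close>

text \<open>The dual constraint is integrated against each admissible \<open>F\<close>. It does not
  involve \<open>\<epsilon>\<close>, so one feasible triple gives a lower bound at every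
  level.\<close>

lemma weak_duality:
  fixes g :: "'n::finite \<Rightarrow> real \<Rightarrow> real"
  assumes "(b, l, \<eta>) \<in> dual_feasible X B J g"
  shows "ereal (dual_objective \<epsilon> (b, l, \<eta>)) \<le> primal_value X B J g \<epsilon>"
proof -
  have b: "b \<in> B" and l: "\<And>i. 0 \<le> l $ i"
    and feas: "\<And>x. x \<in> X \<Longrightarrow> 0 \<le> J x b + (\<Sum>i\<in>UNIV. l $ i * g i x) + \<eta>"
    using assms by (auto simp: dual_feasible_def)
  have "dual_objective \<epsilon> (b, l, \<eta>) \<le> (\<integral>x. J x b \<partial>F)"
    if F: "F \<in> ambiguity_set X g \<epsilon>" and J: "integrable F (\<lambda>x. J x b)" for F
  proof -
    have "prob_space F" and sets: "sets F = sets (restrict_space borel X)"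
      and g: "\<And>i. integrable F (g i)" "\<And>i. (\<integral>x. g i x \<partial>F) \<le> \<epsilon> $ i"
      using F by (auto simp: ambiguity_set_def distributions_def)
    interpret prob_space F by fact
    have "space F = X"
      using sets_eq_imp_space_eq[OF sets] by (simp add: space_restrict_space)
    then have "0 \<le> (\<integral>x. J x b + (\<Sum>i\<in>UNIV. l $ i * g i x) + \<eta> \<partial>F)"
      using feas by (intro integral_nonneg_AE AE_I2) simp
    also have "\<dots> = (\<integral>x. J x b \<partial>F) + (\<Sum>i\<in>UNIV. l $ i * (\<integral>x. g i x \<partial>F)) + \<eta>"
      using J g(1) by (simp add: prob_space)
    also have "\<dots> \<le> (\<integral>x. J x b \<partial>F) + (\<Sum>i\<in>UNIV. l $ i * \<epsilon> $ i) + \<eta>"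
      using l g(2) by (intro add_mono sum_mono mult_left_mono order_refl)
    finally show ?thesis
      by (simp add: dual_objective_def)
  qed
  then show ?thesis
    unfolding primal_value_def using b by (intro SUP_upper2[of b] INF_greatest) auto
qed

lemma strong_duality:
  fixes g :: "'n::finite \<Rightarrow> real \<Rightarrow> real"
  assumes g: "\<And>i. g i \<in> borel_measurable (restrict_space borel X)"
    and J: "\<And>b. b \<in> B \<Longrightarrow> (\<lambda>x. J x b) \<in> borel_measurable (restrict_space borel X)"
    and slater: "strictly_feasible X g \<epsilon>"
  shows "primal_value X B J g \<epsilon> \<le> (SUP q\<in>dual_feasible X B J g. ereal (dual_objective \<epsilon> q))"
    (is "_ \<le> ?D")
  unfolding primal_value_def
proof (rule SUP_least, rule ccontr)
  fix b assume b: "b \<in> B"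
  let ?p = "INF F\<in>{F \<in> ambiguity_set X g \<epsilon>. integrable F (\<lambda>x. J x b)}. ereal (\<integral>x. J x b \<partial>F)"
  assume "\<not> ?p \<le> ?D"
  then obtain r where r: "?D < ereal r" "ereal r < ?p"
    using ereal_dense2[of ?D ?p] unfolding not_le by blast
  from g J[OF b] slater show False
  proof (cases rule: multipliers_or_distribution[where r = r])
    case (multipliers l)
    \<comment> \<open>The last component is chosen so that the dual objective equals
      \<open>r\<close>.\<close>
    let ?q = "(b, l, - (\<Sum>i\<in>UNIV. l $ i * \<epsilon> $ i) - r)"
    have "?q \<in> dual_feasible X B J g"
      using b multipliers by (auto simp: dual_feasible_def sum_subtractf algebra_simps)
    then have "ereal (dual_objective \<epsilon> ?q) \<le> ?D"
      by (rule SUP_upper)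
    then show False
      using r(1) by (simp add: dual_objective_def)
  next
    case (distribution F)
    then have "?p \<le> ereal (\<integral>x. J x b \<partial>F)"
      by (intro INF_lower) simp
    then show False
      using r(2) distribution(3) by (meson less_ereal.simps(1) less_le_trans not_less_iff_gr_or_eq)
  qed
qed

theorem theorem2:
  fixes X B :: "real set"
    and J :: "real \<Rightarrow> real \<Rightarrow> real"
    and g :: "'n::finite \<Rightarrow> real \<Rightarrow> real"
    and \<epsilon> :: "real ^ 'n"
    and b_opt :: real and l_opt :: "real ^ 'n" and \<eta>_opt :: real
  assumes "convex B"
    and "continuous_on (X \<times> B) (\<lambda>(x, b). J x b)"
    and "\<And>x. x \<in> X \<Longrightarrow> concave_on B (\<lambda>b. J x b)"
    and "\<And>b. b \<in> B \<Longrightarrow> concave_within X (\<lambda>x. J x b)"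
    and "\<And>i. g i \<in> borel_measurable (restrict_space borel X)"
    and "strictly_feasible X g \<epsilon>"
    and "dual_optimal X B J g \<epsilon> (b_opt, l_opt, \<eta>_opt)"
  shows "\<forall>\<Delta>\<epsilon> :: real ^ 'n.
    primal_value X B J g (\<epsilon> - \<Delta>\<epsilon>) \<ge>
      primal_value X B J g \<epsilon> + ereal (\<Sum>i\<in>UNIV. l_opt $ i * \<Delta>\<epsilon> $ i)"
proof
  fix \<Delta>\<epsilon> :: "real ^ 'n"
  let ?p = "(b_opt, l_opt, \<eta>_opt)"
  have feas: "?p \<in> dual_feasible X B J g"
    and opt: "ereal (dual_objective \<epsilon> ?p) =
      (SUP q\<in>dual_feasible X B J g. ereal (dual_objective \<epsilon> q))"
    using assms(7) by (auto simp: dual_optimal_def)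
  have "(\<lambda>x. J x b) \<in> borel_measurable (restrict_space borel X)" if "b \<in> B" for b
  proof (rule borel_measurable_continuous_on_restrict)
    have "continuous_on X ((\<lambda>(x, b). J x b) \<circ> (\<lambda>x. (x, b)))"
      using that by (intro continuous_on_compose continuous_intros
          continuous_on_subset[OF assms(2)]) auto
    then show "continuous_on X (\<lambda>x. J x b)"
      by (simp add: o_def)
  qed
  then have "primal_value X B J g \<epsilon> \<le> ereal (dual_objective \<epsilon> ?p)"
    using strong_duality[OF assms(5) _ assms(6)] opt by simp
  then have "primal_value X B J g \<epsilon> + ereal (\<Sum>i\<in>UNIV. l_opt $ i * \<Delta>\<epsilon> $ i) \<le>
      ereal (dual_objective \<epsilon> ?p) + ereal (\<Sum>i\<in>UNIV. l_opt $ i * \<Delta>\<epsilon> $ i)"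
    by (rule add_right_mono)
  \<comment> \<open>The dual objective is affine in the level with gradient \<open>- l_opt\<close>,
    so lowering the level by \<open>\<Delta>\<epsilon>\<close> adds exactly the inner product with
    \<open>l_opt\<close>.\<close>
  also have "\<dots> = ereal (dual_objective (\<epsilon> - \<Delta>\<epsilon>) ?p)"
    by (simp add: dual_objective_def sum_subtractf algebra_simps)
  also have "\<dots> \<le> primal_value X B J g (\<epsilon> - \<Delta>\<epsilon>)"
    by (rule weak_duality[OF feas])
  finally show "primal_value X B J g (\<epsilon> - \<Delta>\<epsilon>) \<ge>
      primal_value X B J g \<epsilon> + ereal (\<Sum>i\<in>UNIV. l_opt $ i * \<Delta>\<epsilon> $ i)" .
qed

end
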